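(* Let $b\geq 2$ be an integer and let $M\in\mathcal{M}_b(\mathbf{P_1})$. Then $\|M^n\|=\binom{n+b}{n+1}$ for all $n\in\mathbb{N}$ if and only if $M$ is equivalent with $T_b$.
   Context: $\mathbb{N}$ is the set of positive integers and $A=\{1,2,\dots,b\}$. For a real matrix $M=(M_{ij})$, $\|M\|=\sum_{i,j}|M_{ij}|$. $\mathcal{M}_b$ is the family of nonzero $b\times b$ matrices with entries in $\{0,1\}$; $r_i(M)$ and $c_j(M)$ denote the $i$-th row and $j$-th column of $M$. A matrix $M\in\mathcal{M}_b$ satisfies condition $\mathbf{P_1}$ if $r_i(M)\neq\mathbf{0}$ for every $i\in\{j\in A: c_j(M)\neq\mathbf{0}\}$; $\mathcal{M}_b(\mathbf{P_1})$ is the set of all $M\in\mathcal{M}_b$ satisfying $\mathbf{P_1}$. $T_b$ is the $b\times b$ matrix whose $(i,j)$ entry is $1$ if $i\geq j$ and $0$ otherwise. Matrices $M,N\in\mathcal{M}_b$ are equivalent, written $M\sim N$, if there exist pairs $(i_1,j_1),\dots,(i_l,j_l)\in A\times A$ such that $M=P(i_l,j_l)\cdots P(i_1,j_1)\,N\,P(i_1,j_1)\cdots P(i_l,j_l)$, where $P(i,j)$ is the matrix obtained by interchanging the $i$-th and $j$-th rows of the $b\times b$ identity matrix. *)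

theory Defs
  imports "Jordan_Normal_Form.Gauss_Jordan_Elimination"
begin

(* Indices are those of the library matrices: {..<b} plays the role of A = {1, ..., b}
   (shift by one).  Entries are taken in the reals throughout. *)

definition entry_norm :: "real mat \<Rightarrow> real" where
  "entry_norm M = (\<Sum>i<dim_row M. \<Sum>j<dim_col M. \<bar>M $$ (i, j)\<bar>)"

definition zero_one_mats :: "nat \<Rightarrow> real mat set" where
  "zero_one_mats b =
     {M \<in> carrier_mat b b. M \<noteq> 0\<^sub>m b b \<and> (\<forall>i<b. \<forall>j<b. M $$ (i, j) \<in> {0, 1})}"

definition P1 :: "nat \<Rightarrow> real mat \<Rightarrow> bool" where
  "P1 b M \<longleftrightarrow> (\<forall>i \<in> {j. j < b \<and> col M j \<noteq> 0\<^sub>v b}. row M i \<noteq> 0\<^sub>v b)"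

definition zero_one_mats_P1 :: "nat \<Rightarrow> real mat set" where
  "zero_one_mats_P1 b = {M \<in> zero_one_mats b. P1 b M}"

definition T_mat :: "nat \<Rightarrow> real mat" where
  "T_mat b = mat b b (\<lambda>(i, j). if i \<ge> j then 1 else 0)"

definition interchange_mat :: "nat \<Rightarrow> nat \<Rightarrow> nat \<Rightarrow> real mat" where
  "interchange_mat b i j = swaprows i j (1\<^sub>m b)"

(* fold processes the list from its head, so for ps = [(i_1, j_1), ..., (i_l, j_l)] it yields
   P(i_l, j_l) ... P(i_1, j_1) N P(i_1, j_1) ... P(i_l, j_l).  The empty list gives N itself,
   as does any list of pairs (i, i). *)
definition equivalent_mats :: "nat \<Rightarrow> real mat \<Rightarrow> real mat \<Rightarrow> bool" where
  "equivalent_mats b M N \<longleftrightarrow>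
     M \<in> zero_one_mats b \<and> N \<in> zero_one_mats b \<and>
     (\<exists>ps. set ps \<subseteq> {..<b} \<times> {..<b} \<and>
        M = fold (\<lambda>(i, j) X. interchange_mat b i j * X * interchange_mat b i j) ps N)"

end

(* Write N = M - 1. The sums of the entries of M N^k are the k-th differences of the counting
   sequence binom (n + b) (b - 1), a polynomial of degree b - 1 in n. This forces N to be similar
   to a nilpotent shift, so all its powers have trace 0. Trace 0 of N, N^2, N^3 means, for the
   digraph of M, that every vertex has a loop and that there are no cycles of length 2 or 3. The
   number of edges (n = 1) then makes the non-loop edges a tournament without 3-cycles, that is, a
   strict linear order, and ranking the vertices turns M into T_b. Conversely, the row sums of the
   powers of T_b are given by the hockey-stick identity. *)
theory Submission
  imports Defs "Jordan_Normal_Form.Determinant" "HOL-Combinatorics.Permutations"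
begin

section \<open>Entry sums, traces, and the nilpotent shift\<close>

text \<open>No absolute values are taken, in contrast to \<open>entry_norm\<close>, so that the sum
  is additive on differences of matrices; on nonnegative matrices the two agree.\<close>

definition mat_sum :: "nat \<Rightarrow> 'a :: comm_monoid_add mat \<Rightarrow> 'a" where
  "mat_sum b A = (\<Sum>i<b. \<Sum>j<b. A $$ (i, j))"

definition mat_tr :: "nat \<Rightarrow> 'a :: comm_monoid_add mat \<Rightarrow> 'a" where
  "mat_tr b A = (\<Sum>i<b. A $$ (i, i))"

text \<open>The ones lie below the diagonal, so right multiplication by this matrix moves column
  \<open>Suc j\<close> into column \<open>j\<close> and makes the last column zero.\<close>

definition shift_mat :: "nat \<Rightarrow> 'a :: zero_neq_one mat" where
  "shift_mat b = mat b b (\<lambda>(i, j). if i = Suc j then 1 else 0)"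

text \<open>Conjugation by a permutation matrix in entrywise form: a relabelling of the vertices of
  the digraph of \<open>A\<close>.\<close>

definition perm_conj_mat :: "nat \<Rightarrow> (nat \<Rightarrow> nat) \<Rightarrow> 'a mat \<Rightarrow> 'a mat" where
  "perm_conj_mat b p A = mat b b (\<lambda>(i, j). A $$ (p i, p j))"

lemma mult_mat_entry:
  assumes "A \<in> carrier_mat n m" "B \<in> carrier_mat m l" "i < n" "j < l"
  shows "(A * B) $$ (i, j) = (\<Sum>k<m. A $$ (i, k) * B $$ (k, j))"
  using assms by (simp add: scalar_prod_def lessThan_atLeast0)

lemma pow_mat_add:
  assumes A: "A \<in> carrier_mat n n"
  shows "A ^\<^sub>m (i + j) = A ^\<^sub>m i * A ^\<^sub>m j"
proof (induction j)
  case 0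
  then show ?case using A pow_carrier_mat[OF A, of i] by simp
next
  case (Suc j)
  then show ?case
    using assoc_mult_mat[OF pow_carrier_mat[OF A, of i] pow_carrier_mat[OF A, of j] A] by simp
qed

lemma pow_mat_Suc_left:
  assumes A: "A \<in> carrier_mat n n"
  shows "A ^\<^sub>m Suc j = A * A ^\<^sub>m j"
  using pow_mat_add[OF A, of 1 j] A by simp

lemma mat_sum_minus:
  fixes A :: "'a :: ab_group_add mat"
  assumes "A \<in> carrier_mat b b" "B \<in> carrier_mat b b"
  shows "mat_sum b (A - B) = mat_sum b A - mat_sum b B"
  using assms by (simp add: mat_sum_def sum_subtractf)

lemma mat_tr_mult_commute:
  fixes A :: "'a :: comm_semiring_0 mat"
  assumes "A \<in> carrier_mat b b" "B \<in> carrier_mat b b"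
  shows "mat_tr b (A * B) = mat_tr b (B * A)"
proof -
  have "mat_tr b (A * B) = (\<Sum>i<b. \<Sum>k<b. A $$ (i, k) * B $$ (k, i))"
    unfolding mat_tr_def using assms by (intro sum.cong) (auto simp: mult_mat_entry simp del: index_mult_mat)
  also have "\<dots> = (\<Sum>k<b. \<Sum>i<b. B $$ (k, i) * A $$ (i, k))"
    by (subst sum.swap) (simp add: mult.commute)
  also have "\<dots> = mat_tr b (B * A)"
    unfolding mat_tr_def using assms by (intro sum.cong) (auto simp: mult_mat_entry simp del: index_mult_mat)
  finally show ?thesis .
qed

lemma mat_tr_similar:
  fixes A :: "'a :: comm_semiring_1 mat"
  assumes A: "A \<in> carrier_mat b b" and sim: "similar_mat_wit A B P Q"
  shows "mat_tr b A = mat_tr b B"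
proof -
  note w = similar_mat_witD2[OF A sim]
  have "mat_tr b A = mat_tr b (P * (B * Q))"
    using w assoc_mult_mat[OF w(6) w(5) w(7)] by simp
  also have "\<dots> = mat_tr b (B * Q * P)"
    using w by (intro mat_tr_mult_commute) auto
  also have "B * Q * P = B"
    using w assoc_mult_mat[OF w(5) w(7) w(6)] by simp
  finally show ?thesis .
qed

lemma shift_mat_carrier [simp]: "shift_mat b \<in> carrier_mat b b"
  by (simp add: shift_mat_def)

lemma shift_mat_pow_entry:
  assumes "i < b" "j < b"
  shows "(shift_mat b ^\<^sub>m k :: 'a :: comm_semiring_1 mat) $$ (i, j) = (if i = j + k then 1 else 0)"
  using assms
proof (induction k arbitrary: i j)
  case 0
  then show ?case by (simp add: shift_mat_def)
next
  case (Suc k)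
  let ?J = "shift_mat b :: 'a mat"
  have "(?J ^\<^sub>m Suc k) $$ (i, j) = (\<Sum>l<b. (?J ^\<^sub>m k) $$ (i, l) * ?J $$ (l, j))"
    using Suc.prems by (simp only: pow_mat.simps) (rule mult_mat_entry, auto)
  also have "\<dots> = (\<Sum>l<b. if l = Suc j then (if i = l + k then 1 else 0) else 0)"
    using Suc by (intro sum.cong) (auto simp: shift_mat_def)
  also have "\<dots> = (if i = j + Suc k then 1 else 0)"
    using Suc.prems by (auto simp: sum.delta')
  finally show ?case .
qed

lemma mat_tr_shift_mat_pow:
  assumes "k > 0"
  shows "mat_tr b (shift_mat b ^\<^sub>m k :: 'a :: comm_semiring_1 mat) = 0"
  using assms by (auto simp: mat_tr_def shift_mat_pow_entry)

lemma invertible_mat_obtain: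
  fixes A :: "'a :: field mat"
  assumes A: "A \<in> carrier_mat n n" and d: "det A \<noteq> 0"
  obtains B where "B \<in> carrier_mat n n" "A * B = 1\<^sub>m n" "B * A = 1\<^sub>m n"
  using det_non_zero_imp_unit[OF A d, of "()"] unfolding Units_def ring_mat_def by auto

section \<open>Finite differences of the counting sequence and similarity to the shift\<close>

text \<open>With the all-ones vector on both sides, the product splits into the column sums of
  \<open>A\<close> paired with the row sums of \<open>B\<close>. This is how entry sums of products
  become entries of \<open>L * K\<close> below.\<close>

lemma mat_sum_mult:
  fixes A :: "'a :: comm_semiring_0 mat"
  assumes "A \<in> carrier_mat b b" "B \<in> carrier_mat b b"
  shows "mat_sum b (A * B) = (\<Sum>m<b. (\<Sum>k<b. A $$ (k, m)) * (\<Sum>l<b. B $$ (m, l)))"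
proof -
  have "mat_sum b (A * B) = (\<Sum>k<b. \<Sum>l<b. \<Sum>m<b. A $$ (k, m) * B $$ (m, l))"
    unfolding mat_sum_def using assms by (intro sum.cong) (auto simp: mult_mat_entry simp del: index_mult_mat)
  also have "\<dots> = (\<Sum>k<b. \<Sum>m<b. \<Sum>l<b. A $$ (k, m) * B $$ (m, l))"
    by (intro sum.cong sum.swap refl)
  also have "\<dots> = (\<Sum>m<b. \<Sum>k<b. \<Sum>l<b. A $$ (k, m) * B $$ (m, l))"
    by (rule sum.swap)
  also have "\<dots> = (\<Sum>m<b. (\<Sum>k<b. A $$ (k, m)) * (\<Sum>l<b. B $$ (m, l)))"
    by (simp add: sum_product)
  finally show ?thesis .
qed

text \<open>Each factor \<open>M - 1\<close> takes a forward difference in \<open>n\<close>, and by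
  Pascal's rule a difference lowers the lower binomial index by one. After \<open>b\<close> steps
  the polynomial of degree \<open>b - 1\<close> is exhausted.\<close>

lemma mat_sum_finite_difference:
  fixes M :: "real mat"
  assumes M: "M \<in> carrier_mat b b" and b: "b \<ge> 1"
    and cnt: "\<And>n. n \<ge> 1 \<Longrightarrow> mat_sum b (M ^\<^sub>m n) = real ((n + b) choose (n + 1))"
    and n: "n \<ge> 1"
  shows "mat_sum b (M ^\<^sub>m n * (M - 1\<^sub>m b) ^\<^sub>m k) =
    (if k < b then real ((n + b) choose (b - 1 - k)) else 0)"
  using n
proof (induction k arbitrary: n)
  case 0
  \<comment> \<open>In this form the lower index does not depend on \<open>n\<close>, so differences
    in \<open>n\<close> act by Pascal's rule.\<close>
  have "(n + b) choose (n + 1) = (n + b) choose (b - 1)"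
    using b by (subst binomial_symmetric) auto
  then show ?case using 0 b cnt[OF 0] M pow_carrier_mat[OF M, of n] by simp
next
  case (Suc k)
  let ?N = "M - 1\<^sub>m b"
  have N: "?N \<in> carrier_mat b b" by (intro minus_carrier_mat one_carrier_mat)
  note c = pow_carrier_mat[OF M] pow_carrier_mat[OF N]
  have "M ^\<^sub>m n * ?N ^\<^sub>m Suc k = M ^\<^sub>m n * ?N * ?N ^\<^sub>m k"
    unfolding pow_mat_Suc_left[OF N] using assoc_mult_mat[OF c(1) N c(2)] by simp
  also have "M ^\<^sub>m n * ?N = M ^\<^sub>m Suc n - M ^\<^sub>m n"
    using mult_minus_distrib_mat[OF c(1) M one_carrier_mat[of b], of n] right_mult_one_mat[OF c(1)] by simp
  also have "\<dots> * ?N ^\<^sub>m k = M ^\<^sub>m Suc n * ?N ^\<^sub>m k - M ^\<^sub>m n * ?N ^\<^sub>m k"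
    by (rule minus_mult_distrib_mat[OF c(1) c(1) c(2)])
  finally have "mat_sum b (M ^\<^sub>m n * ?N ^\<^sub>m Suc k) =
      mat_sum b (M ^\<^sub>m Suc n * ?N ^\<^sub>m k) - mat_sum b (M ^\<^sub>m n * ?N ^\<^sub>m k)"
    using mat_sum_minus[OF mult_carrier_mat[OF c] mult_carrier_mat[OF c]] by metis
  also have "\<dots> = (if k < b then real ((Suc n + b) choose (b - 1 - k)) else 0) -
      (if k < b then real ((n + b) choose (b - 1 - k)) else 0)"
    using Suc.IH[of n] Suc.IH[of "Suc n"] Suc.prems by simp
  also have "\<dots> = (if Suc k < b then real ((n + b) choose (b - 1 - Suc k)) else 0)"
  proof (cases "Suc k < b")
    case True
    \<comment> \<open>Naming the gap \<open>r\<close> removes the truncated subtractions and leaves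
      plain Pascal.\<close>
    then obtain r where "b = Suc (Suc (r + k))"
      by (metis add.commute add_Suc less_iff_Suc_add)
    then show ?thesis by simp
  next
    \<comment> \<open>For \<open>k = b - 1\<close> both binomials have lower index 0 and cancel as 1
      - 1; for larger \<open>k\<close> both terms are already 0.\<close>
    case False
    then have "b - 1 - k = 0" by simp
    then show ?thesis using False by simp
  qed
  finally show ?case .
qed

text \<open>The all-ones vector is cyclic for \<open>M - 1\<close>: the columns of \<open>K\<close> are the iterates of this
  vector, and the rows of \<open>L\<close> serve to prove them independent, since \<open>L * K\<close> is unitriangular.\<close>

lemma mat_minus_one_similar_shift:
  fixes M :: "real mat"
  assumes M: "M \<in> carrier_mat b b" and b: "b \<ge> 1"
    and cnt: "\<And>n. n \<ge> 1 \<Longrightarrow> mat_sum b (M ^\<^sub>m n) = real ((n + b) choose (n + 1))"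
  obtains P Q where "similar_mat_wit (M - 1\<^sub>m b) (shift_mat b) P Q"
proof -
  let ?N = "M - 1\<^sub>m b" and ?J = "shift_mat b :: real mat"
  have N: "?N \<in> carrier_mat b b" by (intro minus_carrier_mat one_carrier_mat)
  note c = pow_carrier_mat[OF N]
  \<comment> \<open>The reversed exponent makes entry \<open>(i, j)\<close> of \<open>L * K\<close>
    belong to the power \<open>b - 1 - i + j\<close>, which stays below \<open>b\<close> exactly for
    \<open>j \<le> i\<close> and equals \<open>b - 1\<close>, with value 1, on the diagonal. The
    factor \<open>M\<close> is there because the counting hypothesis starts at
    \<open>n = 1\<close>.\<close>
  define L where "L = mat b b (\<lambda>(i, j). \<Sum>k<b. (M * ?N ^\<^sub>m (b - 1 - i)) $$ (k, j))"
  define K where "K = mat b b (\<lambda>(i, j). \<Sum>k<b. (?N ^\<^sub>m j) $$ (i, k))"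
  have L: "L \<in> carrier_mat b b" and K: "K \<in> carrier_mat b b"
    by (simp_all add: L_def K_def)
  have sum_pow: "mat_sum b (M * ?N ^\<^sub>m i * ?N ^\<^sub>m j) =
      (if i + j < b then real ((1 + b) choose (b - 1 - (i + j))) else 0)" for i j
    using mat_sum_finite_difference[OF M b cnt, of 1 "i + j"] M
      pow_mat_add[OF N, of i j] assoc_mult_mat[OF M c c, of i j] by simp
  \<comment> \<open>Here \<open>j\<close> is unbounded: the exponent \<open>b\<close> occurs in the
    last column of \<open>?N * K\<close>.\<close>
  have L_mult: "(\<Sum>m<b. L $$ (i, m) * (\<Sum>l<b. (?N ^\<^sub>m j) $$ (m, l))) =
      (if b - 1 - i + j < b then real ((1 + b) choose (b - 1 - (b - 1 - i + j))) else 0)"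
    if "i < b" for i j
  proof -
    have "(\<Sum>m<b. L $$ (i, m) * (\<Sum>l<b. (?N ^\<^sub>m j) $$ (m, l))) =
        mat_sum b (M * ?N ^\<^sub>m (b - 1 - i) * ?N ^\<^sub>m j)"
      using that mult_carrier_mat[OF M c] by (subst mat_sum_mult) (auto simp: L_def intro!: c)
    then show ?thesis by (simp only: sum_pow)
  qed
  have LK: "(L * K) $$ (i, j) = (if b - 1 - i + j < b
      then real ((1 + b) choose (b - 1 - (b - 1 - i + j))) else 0)" if "i < b" "j < b" for i j
    unfolding mult_mat_entry[OF L K that] L_mult[OF that(1), symmetric]
    using that by (auto simp: K_def)
  have "det (L * K) = prod_list (diag_mat (L * K))"
    using mult_carrier_mat[OF L K] by (intro det_lower_triangular[of b]) (auto simp: LK simp del: index_mult_mat)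
  also have "\<dots> = 1"
    unfolding prod_list_diag_prod using L K LK by (intro prod.neutral) auto
  finally have "det L * det K = 1"
    using det_mult[OF L K] by simp
  then have dets: "det L \<noteq> 0" "det K \<noteq> 0" by auto
  obtain L' where L': "L' \<in> carrier_mat b b" "L' * L = 1\<^sub>m b"
    using invertible_mat_obtain[OF L dets(1)] by blast
  obtain K' where K': "K' \<in> carrier_mat b b" "K * K' = 1\<^sub>m b" "K' * K = 1\<^sub>m b"
    using invertible_mat_obtain[OF K dets(2)] by blast
  have NK: "(?N * K) $$ (m, j) = (\<Sum>l<b. (?N ^\<^sub>m Suc j) $$ (m, l))" if "m < b" "j < b" for m j
  proof -
    have "(?N * K) $$ (m, j) = (\<Sum>k<b. ?N $$ (m, k) * (\<Sum>l<b. (?N ^\<^sub>m j) $$ (k, l)))"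
      unfolding mult_mat_entry[OF N K that] using that by (simp add: K_def)
    also have "\<dots> = (\<Sum>l<b. \<Sum>k<b. ?N $$ (m, k) * (?N ^\<^sub>m j) $$ (k, l))"
      by (simp only: sum_distrib_left) (rule sum.swap)
    also have "\<dots> = (\<Sum>l<b. (?N ^\<^sub>m Suc j) $$ (m, l))"
      unfolding pow_mat_Suc_left[OF N] using that
      by (intro sum.cong refl mult_mat_entry[OF N c, symmetric]) auto
    finally show ?thesis .
  qed
  \<comment> \<open>The last column asserts that \<open>?N ^\<^sub>m b\<close> kills the all-ones
    vector. Only entry sums are known, so the equality is tested against the rows of
    \<open>L\<close>, and the invertible \<open>L\<close> is cancelled afterwards.\<close>
  have "L * (?N * K) = L * (K * ?J)"
  proof (rule eq_matI)
    fix i j assume "i < dim_row (L * (K * ?J))" "j < dim_col (L * (K * ?J))"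
    then have ij: "i < b" "j < b" using L by (auto simp: shift_mat_def)
    have "(L * (?N * K)) $$ (i, j) = (if b - 1 - i + Suc j < b
        then real ((1 + b) choose (b - 1 - (b - 1 - i + Suc j))) else 0)"
      unfolding mult_mat_entry[OF L mult_carrier_mat[OF N K] ij] L_mult[OF ij(1), symmetric]
      using ij by (intro sum.cong) (auto simp: NK simp del: index_mult_mat pow_mat.simps)
    \<comment> \<open>If \<open>Suc j = b\<close>, no index \<open>l\<close> matches, and the left
      side is 0 because its exponent is at least \<open>b\<close>.\<close>
    also have "\<dots> = (\<Sum>l<b. if l = Suc j then (L * K) $$ (i, l) else 0)"
      using ij by (auto simp: sum.delta' LK simp del: index_mult_mat)
    also have "\<dots> = (\<Sum>l<b. (L * K) $$ (i, l) * ?J $$ (l, j))"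
      using ij by (intro sum.cong) (auto simp: shift_mat_def)
    also have "\<dots> = (L * K * ?J) $$ (i, j)"
      by (rule mult_mat_entry[OF mult_carrier_mat[OF L K] _ ij, symmetric]) simp
    also have "L * K * ?J = L * (K * ?J)"
      by (rule assoc_mult_mat[OF L K shift_mat_carrier])
    finally show "(L * (?N * K)) $$ (i, j) = (L * (K * ?J)) $$ (i, j)" .
  qed (use L K in \<open>auto simp: shift_mat_def\<close>)
  then have "L' * L * (?N * K) = L' * L * (K * ?J)"
    using assoc_mult_mat[OF L'(1) L mult_carrier_mat[OF N K]]
      assoc_mult_mat[OF L'(1) L mult_carrier_mat[OF K shift_mat_carrier]] by simp
  then have eq: "?N * K = K * ?J"
    using mult_carrier_mat[OF N K] mult_carrier_mat[OF K shift_mat_carrier]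
    by (simp only: L'(2) left_mult_one_mat)
  have "?N = ?N * (K * K')"
    using N K'(2) by simp
  also have "\<dots> = K * ?J * K'"
    using assoc_mult_mat[OF N K K'(1)] eq by simp
  finally have "similar_mat_wit ?N ?J K K'"
    using K K' N by (intro similar_mat_witI[of _ _ b]) auto
  then show ?thesis by (rule that)
qed

lemma mat_tr_minus_one_pow:
  fixes M :: "real mat"
  assumes M: "M \<in> carrier_mat b b" and b: "b \<ge> 1"
    and cnt: "\<And>n. n \<ge> 1 \<Longrightarrow> mat_sum b (M ^\<^sub>m n) = real ((n + b) choose (n + 1))"
    and k: "k > 0"
  shows "mat_tr b ((M - 1\<^sub>m b) ^\<^sub>m k) = 0"
proof -
  obtain P Q where "similar_mat_wit (M - 1\<^sub>m b) (shift_mat b) P Q"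
    using mat_minus_one_similar_shift[OF M b cnt] by blast
  then have "similar_mat_wit ((M - 1\<^sub>m b) ^\<^sub>m k) (shift_mat b ^\<^sub>m k) P Q"
    by (rule similar_mat_wit_pow)
  moreover have "(M - 1\<^sub>m b) ^\<^sub>m k \<in> carrier_mat b b"
    by (intro pow_carrier_mat minus_carrier_mat one_carrier_mat)
  ultimately show ?thesis
    using mat_tr_similar mat_tr_shift_mat_pow[OF k] by metis
qed

section \<open>From vanishing traces to a linear order\<close>

lemma sum_sum_nonneg_eq_0D:
  fixes f :: "nat \<Rightarrow> nat \<Rightarrow> 'a :: ordered_comm_monoid_add"
  assumes "(\<Sum>i<n. \<Sum>j<m. f i j) = 0" "\<And>i j. \<lbrakk>i < n; j < m\<rbrakk> \<Longrightarrow> f i j \<ge> 0" "i < n" "j < m"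
  shows "f i j = 0"
proof -
  have "(\<Sum>j<m. f i j) = 0"
    using assms(1-3) by (subst (asm) sum_nonneg_eq_0_iff) (auto intro: sum_nonneg)
  then show ?thesis
    using assms(2-4) by (subst (asm) sum_nonneg_eq_0_iff) auto
qed

text \<open>Rank a vertex by its number of out-neighbours. Transitivity and irreflexivity make the
  rank strictly decrease along edges, totality then makes it injective, and an injective self-map of
  a finite set is a bijection.\<close>

lemma finite_strict_total_order_ranking:
  fixes E :: "nat \<Rightarrow> nat \<Rightarrow> bool"
  assumes irr: "\<And>i. i < b \<Longrightarrow> \<not> E i i"
    and tr: "\<And>i j k. \<lbrakk>i < b; j < b; k < b; E i j; E j k\<rbrakk> \<Longrightarrow> E i k"
    and tot: "\<And>i j. \<lbrakk>i < b; j < b; i \<noteq> j\<rbrakk> \<Longrightarrow> E i j \<or> E j i"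
  obtains p where "p permutes {..<b}" "\<And>i j. \<lbrakk>i < b; j < b\<rbrakk> \<Longrightarrow> E i j \<longleftrightarrow> p j < p i"
proof -
  define r where "r i = card {k. k < b \<and> E i k}" for i
  \<comment> \<open>The identity outside \<open>{..<b}\<close> is what \<open>permutes\<close>
    demands.\<close>
  define p where "p i = (if i < b then r i else i)" for i
  have mono: "r j < r i" if "i < b" "j < b" "E i j" for i j
    unfolding r_def
  proof (rule psubset_card_mono)
    \<comment> \<open>The inclusion is strict because \<open>j\<close> lies in the second set
      only.\<close>
    show "{k. k < b \<and> E j k} \<subset> {k. k < b \<and> E i k}"
      using that irr[of j] tr[of i j] by blast
  qed simp
  have r_less: "r i < b" if "i < b" for i
  proof -
    have "r i < card {..<b}"
      unfolding r_def using that irr[of i] by (intro psubset_card_mono) auto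
    then show ?thesis by simp
  qed
  have "inj_on p {..<b}"
    using tot mono by (intro inj_onI) (fastforce simp: p_def)
  moreover have "p ` {..<b} \<subseteq> {..<b}"
    using r_less by (auto simp: p_def)
  ultimately have "bij_betw p {..<b} {..<b}"
    by (simp add: bij_betw_def endo_inj_surj)
  then have "p permutes {..<b}"
    by (rule bij_imp_permutes) (simp add: p_def)
  moreover have "E i j \<longleftrightarrow> p j < p i" if "i < b" "j < b" for i j
    using that mono[of i j] mono[of j i] tot[of i j] irr[of i]
    by (cases "i = j") (auto simp: p_def)
  ultimately show ?thesis by (rule that)
qed

lemma binary_mat_eq_perm_conj_T_mat:
  fixes M :: "real mat"
  assumes M: "M \<in> carrier_mat b b" and b: "b \<ge> 1"
    and bin: "\<And>i j. \<lbrakk>i < b; j < b\<rbrakk> \<Longrightarrow> M $$ (i, j) \<in> {0, 1}"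
    and cnt: "\<And>n. n \<ge> 1 \<Longrightarrow> mat_sum b (M ^\<^sub>m n) = real ((n + b) choose (n + 1))"
  obtains p where "p permutes {..<b}" "M = perm_conj_mat b p (T_mat b)"
proof -
  let ?N = "M - 1\<^sub>m b"
  have N: "?N \<in> carrier_mat b b" by (intro minus_carrier_mat one_carrier_mat)
  note tr0 = mat_tr_minus_one_pow[OF M b cnt]
  have "mat_tr b ?N = 0" using tr0[of 1] N by simp
  \<comment> \<open>The sign is reversed to obtain nonnegative summands; their vanishing sum puts a
    loop at every vertex.\<close>
  then have "(\<Sum>i<b. 1 - M $$ (i, i)) = 0"
    using M by (simp add: mat_tr_def sum_subtractf)
  moreover have "1 - M $$ (i, i) \<ge> 0" if "i < b" for i
    using bin[OF that that] by auto
  ultimately have "\<forall>i\<in>{..<b}. 1 - M $$ (i, i) = 0"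
    by (subst (asm) sum_nonneg_eq_0_iff) auto
  then have diag: "M $$ (i, i) = 1" if "i < b" for i
    using that by simp
  \<comment> \<open>From here on \<open>?N\<close> is the adjacency matrix of the non-loop edges, so
    its traces are sums of nonnegative terms over closed walks, and every term vanishes.\<close>
  have N_eq: "?N $$ (i, j) = (if i = j then 0 else M $$ (i, j))" if "i < b" "j < b" for i j
    using that M diag by simp
  have N_nonneg: "?N $$ (i, j) \<ge> 0" if "i < b" "j < b" for i j
    using bin[OF that] N_eq[OF that] by auto
  have "mat_tr b (?N * ?N) = 0"
    using tr0[of 2] N by (simp add: numeral_2_eq_2)
  then have "(\<Sum>i<b. \<Sum>j<b. ?N $$ (i, j) * ?N $$ (j, i)) = 0"
    unfolding mat_tr_def by (simp add: mult_mat_entry[OF N N] del: index_mult_mat index_minus_mat)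
  then have no2: "?N $$ (i, j) * ?N $$ (j, i) = 0" if "i < b" "j < b" for i j
    by (rule sum_sum_nonneg_eq_0D) (use that N_nonneg in \<open>auto intro: mult_nonneg_nonneg simp del: index_minus_mat\<close>)
  have "mat_tr b (?N * ?N * ?N) = 0"
    using tr0[of 3] N by (simp add: numeral_3_eq_3)
  then have "(\<Sum>i<b. \<Sum>k<b. (\<Sum>j<b. ?N $$ (i, j) * ?N $$ (j, k)) * ?N $$ (k, i)) = 0"
    unfolding mat_tr_def
    by (simp add: mult_mat_entry[OF mult_carrier_mat[OF N N] N] mult_mat_entry[OF N N]
        del: index_mult_mat index_minus_mat)
  then have no3_sum: "(\<Sum>j<b. ?N $$ (i, j) * ?N $$ (j, k)) * ?N $$ (k, i) = 0" if "i < b" "k < b" for i k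
    by (rule sum_sum_nonneg_eq_0D)
      (use that N_nonneg in \<open>auto intro!: mult_nonneg_nonneg sum_nonneg simp del: index_minus_mat\<close>)
  have no3: "?N $$ (i, j) * ?N $$ (j, k) * ?N $$ (k, i) = 0" if ijk: "i < b" "j < b" "k < b" for i j k
  proof -
    have "(\<Sum>j<b. ?N $$ (i, j) * ?N $$ (j, k) * ?N $$ (k, i)) = 0"
      using no3_sum[OF ijk(1,3)] by (simp only: sum_distrib_right)
    then have "\<forall>j\<in>{..<b}. ?N $$ (i, j) * ?N $$ (j, k) * ?N $$ (k, i) = 0"
      using ijk N_nonneg by (subst (asm) sum_nonneg_eq_0_iff) (auto simp del: index_minus_mat)
    then show ?thesis using ijk(2) by blast
  qed
  define E where "E i j \<longleftrightarrow> i \<noteq> j \<and> M $$ (i, j) = 1" for i j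
  have EN: "E i j \<longleftrightarrow> ?N $$ (i, j) \<noteq> 0" if "i < b" "j < b" for i j
    using that bin[OF that] by (auto simp: E_def N_eq simp del: index_minus_mat)
  \<comment> \<open>For \<open>i \<noteq> j\<close> this is 1 minus the number of edges between
    \<open>i\<close> and \<open>j\<close>, nonnegative because there are no 2-cycles; on the
    diagonal it is 0. Its total vanishes by the edge count, so each pair carries exactly one
    edge.\<close>
  define D where "D i j = 1 + (if i = j then 1 else 0) - M $$ (i, j) - M $$ (j, i)" for i j
  have D_nonneg: "D i j \<ge> 0" if "i < b" "j < b" for i j
    using no2[OF that] bin[OF that] bin[OF that(2,1)] diag that
    by (auto simp: D_def N_eq simp del: index_minus_mat)
  have D_sum: "(\<Sum>i<b. \<Sum>j<b. D i j) = real b * real b + real b - 2 * mat_sum b M"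
  proof -
    have "(\<Sum>i<b. \<Sum>j<b. M $$ (j, i)) = mat_sum b M"
      unfolding mat_sum_def by (rule sum.swap)
    moreover have "(\<Sum>i<b. \<Sum>j<b. M $$ (i, j)) = mat_sum b M"
      by (simp add: mat_sum_def)
    ultimately show ?thesis
      by (simp add: D_def sum_subtractf sum.distrib distrib_left)
  qed
  have M_sum: "mat_sum b M = real (Suc b choose 2)"
    using cnt[of 1] M by (simp add: numeral_2_eq_2)
  have "(Suc b choose 2) * 2 = Suc b * b"
    unfolding choose_two diff_Suc_1 by (rule dvd_div_mult_self) simp
  then have "real (Suc b choose 2) * 2 = (real b + 1) * real b"
    by (metis of_nat_Suc of_nat_mult of_nat_numeral add.commute)
  then have "real (Suc b choose 2) * 2 = real b * real b + real b"
    by (simp only: distrib_right mult_1)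
  then have "(\<Sum>i<b. \<Sum>j<b. D i j) = 0"
    unfolding D_sum M_sum by linarith
  then have D0: "D i j = 0" if "i < b" "j < b" for i j
    by (rule sum_sum_nonneg_eq_0D) (use that D_nonneg in auto)
  have tot: "E i j \<or> E j i" if "i < b" "j < b" "i \<noteq> j" for i j
    using D0[OF that(1,2)] bin[OF that(1,2)] bin[OF that(2,1)] that(3) by (auto simp: D_def E_def)
  have irr: "\<not> E i i" for i by (simp add: E_def)
  \<comment> \<open>If \<open>i = k\<close>, the two edges would form a 2-cycle. Otherwise an edge
    from \<open>k\<close> to \<open>i\<close> would close a 3-cycle, so totality gives the edge from
    \<open>i\<close> to \<open>k\<close>.\<close>
  have trans: "E i k" if "i < b" "j < b" "k < b" "E i j" "E j k" for i j k
  proof (cases "i = k")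
    case True
    then show ?thesis using no2[of i j] that EN by auto
  next
    case False
    have "\<not> E k i"
      using no3[of i j k] that EN by auto
    then show ?thesis using tot[of i k] False that by auto
  qed
  obtain p where p: "p permutes {..<b}"
    and E: "\<And>i j. \<lbrakk>i < b; j < b\<rbrakk> \<Longrightarrow> E i j \<longleftrightarrow> p j < p i"
    using finite_strict_total_order_ranking[of b E] irr trans tot by blast
  have "M = perm_conj_mat b p (T_mat b)"
  proof (rule eq_matI)
    fix i j assume "i < dim_row (perm_conj_mat b p (T_mat b))"
      "j < dim_col (perm_conj_mat b p (T_mat b))"
    then have ij: "i < b" "j < b" by (auto simp: perm_conj_mat_def)
    have less: "p i < b" "p j < b"
      using permutes_in_image[OF p] ij by auto
    \<comment> \<open>This matches the loops with the diagonal of \<open>T_mat b\<close>; the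
      relation \<open>E\<close> accounts for the strict part only.\<close>
    have "i = j \<longleftrightarrow> p i = p j"
      using permutes_inj[OF p] by (auto dest: injD)
    then show "M $$ (i, j) = perm_conj_mat b p (T_mat b) $$ (i, j)"
      using ij less E[OF ij] bin[OF ij] diag[OF ij(1)]
      by (auto simp: perm_conj_mat_def T_mat_def E_def)
  qed (use M in \<open>auto simp: perm_conj_mat_def\<close>)
  with p show ?thesis by (rule that)
qed

section \<open>Entry sums of the powers of \<open>T_mat\<close>\<close>

lemma T_mat_carrier [simp]: "T_mat b \<in> carrier_mat b b"
  by (simp add: T_mat_def)

text \<open>Multiplying by \<open>T_mat b\<close> on the left replaces the vector of row sums by its
  partial sums, and the hockey-stick identity evaluates these.\<close>

lemma row_sum_T_mat_pow:
  assumes "i < b"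
  shows "(\<Sum>j<b. (T_mat b ^\<^sub>m n) $$ (i, j)) = real ((i + n) choose n)"
  using assms
proof (induction n arbitrary: i)
  case 0
  then show ?case by (simp add: T_mat_def)
next
  case (Suc n)
  let ?T = "T_mat b"
  have "(\<Sum>j<b. (?T ^\<^sub>m Suc n) $$ (i, j)) = (\<Sum>j<b. \<Sum>k<b. ?T $$ (i, k) * (?T ^\<^sub>m n) $$ (k, j))"
    unfolding pow_mat_Suc_left[OF T_mat_carrier] using Suc.prems
    by (intro sum.cong refl mult_mat_entry) auto
  also have "\<dots> = (\<Sum>k<b. ?T $$ (i, k) * (\<Sum>j<b. (?T ^\<^sub>m n) $$ (k, j)))"
    by (subst sum.swap) (simp add: sum_distrib_left)
  also have "\<dots> = (\<Sum>k<b. if k \<le> i then real ((k + n) choose n) else 0)"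
    using Suc by (intro sum.cong) (auto simp: T_mat_def)
  also have "\<dots> = (\<Sum>k\<le>i. real ((k + n) choose n))"
    using Suc.prems by (intro sum.mono_neutral_cong_right) auto
  \<comment> \<open>The reflected binomial is the form in which \<open>sum_choose_lower\<close>
    states the hockey-stick identity.\<close>
  also have "\<dots> = real (\<Sum>k\<le>i. (n + k) choose k)"
    by (simp add: binomial_symmetric[of n] add.commute)
  also have "\<dots> = real ((i + Suc n) choose Suc n)"
    unfolding sum_choose_lower using binomial_symmetric[of i "Suc (n + i)"]
    by (simp add: add.commute)
  finally show ?case .
qed

text \<open>Adding up the row sums is one more hockey-stick summation, with the row index running to
  \<open>b - 1\<close>.\<close>

lemma mat_sum_T_mat_pow:
  assumes "b \<ge> 1"
  shows "mat_sum b (T_mat b ^\<^sub>m n) = real ((n + b) choose (n + 1))"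
proof -
  obtain c where b: "b = Suc c" using assms by (cases b) auto
  have "mat_sum b (T_mat b ^\<^sub>m n) = (\<Sum>i<b. real ((i + n) choose n))"
    by (simp add: mat_sum_def row_sum_T_mat_pow)
  also have "\<dots> = real (\<Sum>i\<le>c. (n + i) choose i)"
    by (simp add: b lessThan_Suc_atMost binomial_symmetric[of n] add.commute)
  also have "\<dots> = real ((n + b) choose (n + 1))"
    unfolding sum_choose_lower using binomial_symmetric[of c "Suc (n + c)"] by (simp add: b)
  finally show ?thesis .
qed

section \<open>Conjugation by permutations, and interchanges as its generators\<close>

lemma perm_conj_mat_carrier [simp]: "perm_conj_mat b p A \<in> carrier_mat b b"
  by (simp add: perm_conj_mat_def)

text \<open>The inner summation index can be reindexed along \<open>p\<close>, since
  \<open>p\<close> permutes its range.\<close>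

lemma perm_conj_mat_mult:
  fixes A :: "'a :: semiring_0 mat"
  assumes A: "A \<in> carrier_mat b b" and B: "B \<in> carrier_mat b b" and p: "p permutes {..<b}"
  shows "perm_conj_mat b p A * perm_conj_mat b p B = perm_conj_mat b p (A * B)"
proof (rule eq_matI)
  fix i j assume "i < dim_row (perm_conj_mat b p (A * B))" "j < dim_col (perm_conj_mat b p (A * B))"
  then have ij: "i < b" "j < b" by (auto simp: perm_conj_mat_def)
  then have pij: "p i < b" "p j < b" using permutes_in_image[OF p] by auto
  have "(perm_conj_mat b p A * perm_conj_mat b p B) $$ (i, j) =
      (\<Sum>k<b. A $$ (p i, p k) * B $$ (p k, p j))"
    using ij by (subst mult_mat_entry[of _ b b]) (auto simp: perm_conj_mat_def)
  also have "\<dots> = (\<Sum>k<b. A $$ (p i, k) * B $$ (k, p j))"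
    using sum.permute[OF p, of "\<lambda>k. A $$ (p i, k) * B $$ (k, p j)"] by (simp add: comp_def)
  also have "\<dots> = perm_conj_mat b p (A * B) $$ (i, j)"
    using ij mult_mat_entry[OF A B pij] by (simp add: perm_conj_mat_def)
  finally show "(perm_conj_mat b p A * perm_conj_mat b p B) $$ (i, j) =
      perm_conj_mat b p (A * B) $$ (i, j)" .
qed (auto simp: perm_conj_mat_def)

lemma perm_conj_mat_pow:
  fixes A :: "'a :: semiring_1 mat"
  assumes A: "A \<in> carrier_mat b b" and p: "p permutes {..<b}"
  shows "perm_conj_mat b p A ^\<^sub>m n = perm_conj_mat b p (A ^\<^sub>m n)"
proof (induction n)
  case 0
  show ?case
  proof (rule eq_matI)
    fix i j assume "i < dim_row (perm_conj_mat b p (A ^\<^sub>m 0))"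
      "j < dim_col (perm_conj_mat b p (A ^\<^sub>m 0))"
    then have ij: "i < b" "j < b" by (auto simp: perm_conj_mat_def)
    then have "p i < b" "p j < b" using permutes_in_image[OF p] by auto
    moreover have "i = j \<longleftrightarrow> p i = p j"
      using permutes_inj[OF p] by (auto dest: injD)
    ultimately show "(perm_conj_mat b p A ^\<^sub>m 0) $$ (i, j) = perm_conj_mat b p (A ^\<^sub>m 0) $$ (i, j)"
      using ij A by (simp add: perm_conj_mat_def)
  qed (auto simp: perm_conj_mat_def)
next
  case (Suc n)
  then show ?case
    using perm_conj_mat_mult[OF pow_carrier_mat[OF A] A p] by simp
qed

lemma mat_sum_perm_conj:
  assumes p: "p permutes {..<b}"
  shows "mat_sum b (perm_conj_mat b p A) = mat_sum b A"
proof -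
  have "mat_sum b (perm_conj_mat b p A) = (\<Sum>i<b. \<Sum>j<b. A $$ (p i, p j))"
    by (simp add: mat_sum_def perm_conj_mat_def)
  also have "\<dots> = (\<Sum>i<b. \<Sum>j<b. A $$ (p i, j))"
    using sum.permute[OF p, of "\<lambda>j. A $$ (p i, j)" for i] by (simp add: comp_def)
  also have "\<dots> = mat_sum b A"
    using sum.permute[OF p, of "\<lambda>i. \<Sum>j<b. A $$ (i, j)"] by (simp add: comp_def mat_sum_def)
  finally show ?thesis .
qed

text \<open>The order is contravariant: the conjugation performed last contributes the permutation
  that acts first on indices.\<close>

lemma perm_conj_mat_comp:
  assumes q: "q permutes {..<b}"
  shows "perm_conj_mat b q (perm_conj_mat b p A) = perm_conj_mat b (p \<circ> q) A"
  using permutes_in_image[OF q] by (intro eq_matI) (auto simp: perm_conj_mat_def)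

lemma perm_conj_mat_id:
  assumes "A \<in> carrier_mat b b"
  shows "perm_conj_mat b id A = A"
  using assms by (intro eq_matI) (auto simp: perm_conj_mat_def)

lemma interchange_conj:
  assumes X: "X \<in> carrier_mat b b" and ij: "i < b" "j < b"
  shows "interchange_mat b i j * X * interchange_mat b i j =
    perm_conj_mat b (Transposition.transpose i j) X"
proof (rule eq_matI)
  let ?P = "interchange_mat b i j" and ?t = "Transposition.transpose i j"
  have P: "?P \<in> carrier_mat b b" by (simp add: interchange_mat_def)
  have t: "?t k < b" if "k < b" for k
    using ij that by (auto simp: Transposition.transpose_def)
  \<comment> \<open>\<open>P1\<close> and \<open>P2\<close> describe the same entry, as
    \<open>?t\<close> is an involution: the first collapses the sum in the left product, the second
    that in the right product.\<close>
  have P1: "?P $$ (k, l) = (if l = ?t k then 1 else 0)" if "k < b" "l < b" for k l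
    using that ij by (auto simp: interchange_mat_def Transposition.transpose_def)
  have P2: "?P $$ (k, l) = (if k = ?t l then 1 else 0)" if "k < b" "l < b" for k l
    using that ij by (auto simp: interchange_mat_def Transposition.transpose_def)
  fix k l assume "k < dim_row (perm_conj_mat b ?t X)" "l < dim_col (perm_conj_mat b ?t X)"
  then have kl: "k < b" "l < b" by (auto simp: perm_conj_mat_def)
  have row: "(?P * X) $$ (k, m) = X $$ (?t k, m)" if "m < b" for m
  proof -
    have "(?P * X) $$ (k, m) = (\<Sum>r<b. if r = ?t k then X $$ (r, m) else 0)"
      unfolding mult_mat_entry[OF P X kl(1) that] using kl by (intro sum.cong) (auto simp: P1)
    then show ?thesis using t[OF kl(1)] by simp
  qed
  have "(?P * X * ?P) $$ (k, l) = (\<Sum>m<b. if m = ?t l then X $$ (?t k, m) else 0)"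
    unfolding mult_mat_entry[OF mult_carrier_mat[OF P X] P kl]
    using kl by (intro sum.cong) (auto simp: P2 row simp del: index_mult_mat)
  then show "(?P * X * ?P) $$ (k, l) = perm_conj_mat b ?t X $$ (k, l)"
    using t[OF kl(2)] kl by (simp add: perm_conj_mat_def)
qed (use X in \<open>auto simp: perm_conj_mat_def interchange_mat_def\<close>)

lemma fold_interchange_conj:
  assumes "X \<in> carrier_mat b b" "set ps \<subseteq> {..<b} \<times> {..<b}"
  shows "\<exists>p. p permutes {..<b} \<and>
    fold (\<lambda>(i, j) X. interchange_mat b i j * X * interchange_mat b i j) ps X = perm_conj_mat b p X"
  using assms
proof (induction ps arbitrary: X)
  case Nil
  then show ?case using perm_conj_mat_id[OF Nil(1)] permutes_id[of "{..<b}"] by (intro exI[of _ id]) (simp add: id_def)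
next
  case (Cons ij ps)
  obtain i j where ij: "ij = (i, j)" "i < b" "j < b" using Cons.prems by (cases ij) auto
  let ?t = "Transposition.transpose i j"
  obtain p where p: "p permutes {..<b}"
    "fold (\<lambda>(i, j) X. interchange_mat b i j * X * interchange_mat b i j) ps (perm_conj_mat b ?t X)
      = perm_conj_mat b p (perm_conj_mat b ?t X)"
    using Cons.IH[of "perm_conj_mat b ?t X"] Cons.prems by auto
  have "?t permutes {..<b}" using ij by (intro permutes_swap_id) auto
  \<comment> \<open>\<open>fold\<close> performs the head first, so by contravariance its
    transposition stands on the left.\<close>
  then have "?t \<circ> p permutes {..<b}" using p(1) permutes_compose by blast
  then show ?case
    using p ij interchange_conj[OF Cons.prems(1) ij(2,3)] by (auto simp: perm_conj_mat_comp)
qed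

text \<open>Transpositions generate the permutations of a finite set. The reverse induction composes
  a new transposition on the right, which by contravariance is the last interchange and so goes to
  the end of the list.\<close>

lemma perm_conj_mat_as_fold:
  assumes p: "p permutes {..<b}" and X: "X \<in> carrier_mat b b"
  shows "\<exists>ps. set ps \<subseteq> {..<b} \<times> {..<b} \<and> perm_conj_mat b p X =
    fold (\<lambda>(i, j) X. interchange_mat b i j * X * interchange_mat b i j) ps X"
  using finite_lessThan p
proof (induction rule: permutes_rev_induct)
  case id
  then show ?case using perm_conj_mat_id[OF X] by (intro exI[of _ "[]"]) (simp add: id_def)
next
  case (swap i j p)
  let ?t = "Transposition.transpose i j"
  obtain ps where ps: "set ps \<subseteq> {..<b} \<times> {..<b}" "perm_conj_mat b p X =
      fold (\<lambda>(i, j) X. interchange_mat b i j * X * interchange_mat b i j) ps X"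
    using swap by blast
  have "?t permutes {..<b}" using swap by (intro permutes_swap_id) auto
  then have "perm_conj_mat b (p \<circ> ?t) X = perm_conj_mat b ?t (perm_conj_mat b p X)"
    by (simp add: perm_conj_mat_comp)
  also have "\<dots> = interchange_mat b i j * perm_conj_mat b p X * interchange_mat b i j"
    using swap by (intro interchange_conj[symmetric]) auto
  finally show ?case
    using ps(1) swap(1,2) unfolding ps(2) by (intro exI[of _ "ps @ [(i, j)]"]) (simp add: comp_def)
qed

lemma equivalent_mats_iff_perm_conj:
  assumes "M \<in> zero_one_mats b" "N \<in> zero_one_mats b"
  shows "equivalent_mats b M N \<longleftrightarrow> (\<exists>p. p permutes {..<b} \<and> M = perm_conj_mat b p N)"
proof -
  have N: "N \<in> carrier_mat b b" using assms by (simp add: zero_one_mats_def)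
  show ?thesis
  proof
    assume "equivalent_mats b M N"
    then obtain ps where "set ps \<subseteq> {..<b} \<times> {..<b}"
      "M = fold (\<lambda>(i, j) X. interchange_mat b i j * X * interchange_mat b i j) ps N"
      unfolding equivalent_mats_def by blast
    then show "\<exists>p. p permutes {..<b} \<and> M = perm_conj_mat b p N"
      using fold_interchange_conj[OF N] by simp
  next
    assume "\<exists>p. p permutes {..<b} \<and> M = perm_conj_mat b p N"
    then show "equivalent_mats b M N"
      using perm_conj_mat_as_fold[OF _ N] assms unfolding equivalent_mats_def by blast
  qed
qed

section \<open>Nonnegative powers and the characterization\<close>

lemma entry_norm_eq_mat_sum:
  assumes "A \<in> carrier_mat b b" "\<And>i j. \<lbrakk>i < b; j < b\<rbrakk> \<Longrightarrow> A $$ (i, j) \<ge> 0"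
  shows "entry_norm A = mat_sum b A"
  using assms by (auto simp: entry_norm_def mat_sum_def)

lemma pow_mat_nonneg:
  fixes A :: "'a :: linordered_semidom mat"
  assumes A: "A \<in> carrier_mat b b" and nn: "\<And>i j. \<lbrakk>i < b; j < b\<rbrakk> \<Longrightarrow> A $$ (i, j) \<ge> 0"
  shows "\<lbrakk>i < b; j < b\<rbrakk> \<Longrightarrow> (A ^\<^sub>m n) $$ (i, j) \<ge> 0"
proof (induction n arbitrary: i j)
  case 0
  then show ?case using A by auto
next
  case (Suc n)
  then show ?case
    using nn by (simp add: mult_mat_entry[OF pow_carrier_mat[OF A] A] del: index_mult_mat)
      (intro sum_nonneg mult_nonneg_nonneg, auto)
qed

theorem theorem3:
  fixes b :: nat and M :: "real mat"
  assumes "b \<ge> 2"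
    and "M \<in> zero_one_mats_P1 b"
  shows "(\<forall>n\<ge>1. entry_norm (M ^\<^sub>m n) = real ((n + b) choose (n + 1)))
           \<longleftrightarrow> equivalent_mats b M (T_mat b)"
proof -
  have M01: "M \<in> zero_one_mats b" using assms(2) by (simp add: zero_one_mats_P1_def)
  then have M: "M \<in> carrier_mat b b"
    and bin: "\<And>i j. \<lbrakk>i < b; j < b\<rbrakk> \<Longrightarrow> M $$ (i, j) \<in> {0, 1}"
    by (auto simp: zero_one_mats_def)
  have b: "b \<ge> 1" using assms(1) by simp
  \<comment> \<open>The corner entry shows that \<open>T_mat b\<close> is nonzero, as membership in
    \<open>zero_one_mats b\<close> requires.\<close>
  have "T_mat b $$ (0, 0) \<noteq> 0\<^sub>m b b $$ (0, 0)" using b by (simp add: T_mat_def)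
  then have "T_mat b \<noteq> 0\<^sub>m b b" by fastforce
  then have T01: "T_mat b \<in> zero_one_mats b"
    by (auto simp: zero_one_mats_def T_mat_def)
  have nonneg: "M $$ (i, j) \<ge> 0" if "i < b" "j < b" for i j
    using bin[OF that] by auto
  have norm: "entry_norm (M ^\<^sub>m n) = mat_sum b (M ^\<^sub>m n)" for n
    using pow_carrier_mat[OF M] pow_mat_nonneg[OF M nonneg] by (intro entry_norm_eq_mat_sum) auto
  show ?thesis
    unfolding equivalent_mats_iff_perm_conj[OF M01 T01] norm
  proof
    assume "\<forall>n\<ge>1. mat_sum b (M ^\<^sub>m n) = real ((n + b) choose (n + 1))"
    then show "\<exists>p. p permutes {..<b} \<and> M = perm_conj_mat b p (T_mat b)"
      using binary_mat_eq_perm_conj_T_mat[OF M b bin] by blast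
  next
    assume "\<exists>p. p permutes {..<b} \<and> M = perm_conj_mat b p (T_mat b)"
    then show "\<forall>n\<ge>1. mat_sum b (M ^\<^sub>m n) = real ((n + b) choose (n + 1))"
      \<comment> \<open>Conjugation commutes with powers and preserves entry sums, which reduces the
        claim to \<open>T_mat b\<close> itself.\<close>
      by (auto simp: perm_conj_mat_pow mat_sum_perm_conj mat_sum_T_mat_pow[OF b])
  qed
qed

end
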